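(* Let $D_n^{\max}$ denote the largest degree of a vertex of the Moran forest $\mathscr{F}_n$. Then, as $n\to\infty$, \[ D_n^{\max} = \frac{\log n}{\log\log n} + \bigl(1+o_{\mathrm p}(1)\bigr)\,\frac{\log n\,\log\log\log n}{(\log\log n)^2}, \] where $o_{\mathrm p}(1)$ denotes a sequence of random variables that goes to $0$ in probability.
   Context: Moran forest: for fixed $n\ge 2$, consider the Markov chain on directed graphs on $\{1,\ldots,n\}$ whose transitions are: at each time-step, choose an ordered pair of distinct vertices $(u,v)$ uniformly at random; disconnect $v$ from all of its neighbors (remove all edges incident to $v$), then add the edge $\vec{uv}$. This chain has a unique stationary distribution, whose support is the set of non-empty rooted forests (those with at least one edge) on $\{1,\ldots,n\}$. The Moran forest $\mathscr{F}_n$ is a random forest having this stationary distribution. The degree of a vertex is its total degree (in-degree plus out-degree). *)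

theory Defs
  imports "HOL-Probability.Probability"
begin

text \<open>
  A directed graph on the vertex set \<open>{1..n}\<close> is represented by its edge set, a set of ordered pairs
  of distinct vertices; the pair \<open>(u, v)\<close> is the edge from \<open>u\<close> to \<open>v\<close>.
\<close>

type_synonym digraph = "(nat \<times> nat) set"

definition ordered_pairs :: "nat \<Rightarrow> (nat \<times> nat) set" where
  "ordered_pairs n = {(u, v). u \<in> {1..n} \<and> v \<in> {1..n} \<and> u \<noteq> v}"

definition digraphs_on :: "nat \<Rightarrow> digraph set" where
  "digraphs_on n = Pow (ordered_pairs n)"

definition disconnect :: "nat \<Rightarrow> digraph \<Rightarrow> digraph" where
  "disconnect v G = {e \<in> G. fst e \<noteq> v \<and> snd e \<noteq> v}"

definition moran_update :: "nat \<times> nat \<Rightarrow> digraph \<Rightarrow> digraph" where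
  "moran_update = (\<lambda>(u, v) G. insert (u, v) (disconnect v G))"

definition moran_step :: "nat \<Rightarrow> digraph \<Rightarrow> digraph pmf" where
  "moran_step n G = map_pmf (\<lambda>e. moran_update e G) (pmf_of_set (ordered_pairs n))"

definition moran_stationary :: "nat \<Rightarrow> digraph pmf \<Rightarrow> bool" where
  "moran_stationary n p \<longleftrightarrow>
     set_pmf p \<subseteq> digraphs_on n \<and> bind_pmf p (moran_step n) = p"

text \<open>
  The description is meaningful for \<open>n \<ge> 2\<close> only; existence and uniqueness for these \<open>n\<close> is
  \<open>moran_stationary_ex1\<close> below.
\<close>

definition moran_forest :: "nat \<Rightarrow> digraph pmf" where
  "moran_forest n = (THE p. moran_stationary n p)"

definition total_degree :: "digraph \<Rightarrow> nat \<Rightarrow> nat" where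
  "total_degree G v = card {e \<in> G. snd e = v} + card {e \<in> G. fst e = v}"

definition max_degree :: "nat \<Rightarrow> digraph \<Rightarrow> nat" where
  "max_degree n G = Max (total_degree G ` {1..n})"

text \<open>
  The random variables of the sequence need not live on a common probability space.
\<close>

definition tendsto_0_in_prob :: "(nat \<Rightarrow> 'a measure) \<Rightarrow> (nat \<Rightarrow> 'a \<Rightarrow> real) \<Rightarrow> bool" where
  "tendsto_0_in_prob M X \<longleftrightarrow>
     (\<forall>n. X n \<in> borel_measurable (M n)) \<and>
     (\<forall>\<delta>>0. (\<lambda>n. measure (M n) {x \<in> space (M n). \<bar>X n x\<bar> > \<delta>}) \<longlonglongrightarrow> 0)"


subsection \<open>Existence and uniqueness of the stationary distribution\<close>

text \<open>
  Some word \<open>w\<close> of \<open>n - 1\<close> successive choices leads every graph to one and the same graph. An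
  \<open>(n - 1)\<close>-step transition is therefore a mixture of a jump to that graph and a residual kernel, and
  such a kernel has a unique stationary distribution, namely the law of the residual chain started in
  that graph and observed at an independent geometric time.
\<close>

lemma pmf_split_atom:
  fixes A :: "'a pmf"
  assumes w: "w \<in> set_pmf A" and ne: "set_pmf A \<inter> (- {w}) \<noteq> {}"
  shows "A = bind_pmf (bernoulli_pmf (pmf A w))
               (\<lambda>b. if b then return_pmf w else cond_pmf A (- {w}))"
proof (rule pmf_eqI)
  fix i
  have m: "measure_pmf.prob A (- {w}) = 1 - pmf A w"
    using measure_pmf.prob_compl[of "{w}" A] by (simp add: Compl_eq_Diff_UNIV measure_pmf_single)
  have pos: "measure_pmf.prob A (- {w}) \<noteq> 0"
    using ne by (metis Int_emptyI disjoint_iff measure_pmf_posI less_irrefl)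
  have "pmf A w \<le> 1" by (rule pmf_le_1)
  then show "pmf A i = pmf (bind_pmf (bernoulli_pmf (pmf A w))
               (\<lambda>b. if b then return_pmf w else cond_pmf A (- {w}))) i"
    using pos m by (auto simp: pmf_bind pmf_cond[OF ne] pmf_nonneg)
qed

lemma mixture_stationary_iff:
  fixes Q :: "'a \<Rightarrow> 'a pmf" and s :: 'a
  assumes d: "0 < d" "d < 1"
  defines "R \<equiv> (\<lambda>p. bind_pmf (bernoulli_pmf d) (\<lambda>b. if b then return_pmf s else bind_pmf p Q))"
  defines "it \<equiv> (\<lambda>k. (\<lambda>p. bind_pmf p Q) ^^ k)"
  shows "R p = p \<longleftrightarrow> p = bind_pmf (geometric_pmf d) (\<lambda>k. it k (return_pmf s))" (is "_ \<longleftrightarrow> p = ?g")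
proof
  have d': "d \<in> {0<..1}" using d by auto
  have R_step: "R (bind_pmf (geometric_pmf d) f) =
        bind_pmf (geometric_pmf d) (\<lambda>k. case k of 0 \<Rightarrow> return_pmf s | Suc k \<Rightarrow> bind_pmf (f k) Q)"
    for f
    unfolding R_def
    by (subst (2) geometric_bind_pmf_unfold[OF d'])
       (auto simp: bind_assoc_pmf bind_return_pmf bind_map_pmf intro!: bind_pmf_cong)
  show "R p = p" if "p = ?g"
    unfolding that R_step
    by (rule bind_pmf_cong) (auto simp: it_def split: nat.splits)
  assume st: "R p = p"
  have trunc: "p = bind_pmf (geometric_pmf d) (\<lambda>k. if k < N then it k (return_pmf s) else it N p)" for N
  proof (induction N)
    case 0
    then show ?case by (simp add: it_def)
  next
    case (Suc N)
    have "p = R p" using st by simp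
    also have "\<dots> = R (bind_pmf (geometric_pmf d) (\<lambda>k. if k < N then it k (return_pmf s) else it N p))"
      using Suc by (metis (lifting))
    also have "\<dots> = bind_pmf (geometric_pmf d)
                        (\<lambda>k. if k < Suc N then it k (return_pmf s) else it (Suc N) p)"
      unfolding R_step
    proof (rule bind_pmf_cong)
      fix k
      show "(case k of 0 \<Rightarrow> return_pmf s | Suc k \<Rightarrow>
                bind_pmf (if k < N then it k (return_pmf s) else it N p) Q) =
            (if k < Suc N then it k (return_pmf s) else it (Suc N) p)"
        by (cases k) (simp_all add: it_def)
    qed simp
    finally show ?case .
  qed
  show "p = ?g"
  proof (rule pmf_eqI)
    fix y
    let ?h = "\<lambda>N k. pmf (if k < N then it k (return_pmf s) else it N p) y"
    have "(\<lambda>N. \<integral>k. ?h N k \<partial>geometric_pmf d)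
            \<longlonglongrightarrow> (\<integral>k. pmf (it k (return_pmf s)) y \<partial>geometric_pmf d)"
    proof (rule integral_dominated_convergence[where w = "\<lambda>_. 1"])
      show "AE k in geometric_pmf d. (\<lambda>N. ?h N k) \<longlonglongrightarrow> pmf (it k (return_pmf s)) y"
      proof (rule AE_I2)
        fix k
        have "eventually (\<lambda>N. ?h N k = pmf (it k (return_pmf s)) y) sequentially"
          using eventually_gt_at_top[of k] by eventually_elim simp
        then show "(\<lambda>N. ?h N k) \<longlonglongrightarrow> pmf (it k (return_pmf s)) y"
          by (rule tendsto_eventually)
      qed
    qed (auto simp: pmf_le_1)
    moreover have "(\<integral>k. ?h N k \<partial>geometric_pmf d) = pmf p y" for N
      by (subst (2) trunc[of N]) (simp add: pmf_bind)
    ultimately have "(\<lambda>_::nat. pmf p y) \<longlonglongrightarrow> pmf ?g y"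
      by (simp add: pmf_bind)
    then show "pmf p y = pmf ?g y"
      by (simp add: LIMSEQ_const_iff)
  qed
qed

lemma moran_update_digraphs_on:
  "e \<in> ordered_pairs n \<Longrightarrow> G \<in> digraphs_on n \<Longrightarrow> moran_update e G \<in> digraphs_on n"
  by (cases e) (auto simp: moran_update_def digraphs_on_def disconnect_def)

lemma fold_moran_update_digraphs_on:
  "set w \<subseteq> ordered_pairs n \<Longrightarrow> G \<in> digraphs_on n \<Longrightarrow> fold moran_update w G \<in> digraphs_on n"
  by (induction w arbitrary: G) (auto intro: moran_update_digraphs_on)

lemma finite_ordered_pairs [simp]: "finite (ordered_pairs n)"
  by (rule finite_subset[of _ "{1..n} \<times> {1..n}"]) (auto simp: ordered_pairs_def)

lemma coalescing_word:
  assumes G: "G \<in> digraphs_on n" and "m \<le> n - 1"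
  shows "fold moran_update (map (\<lambda>v. (1, v)) [2..<m + 2]) G
           = (Pair 1 ` {2..<m + 2}) \<union> {e \<in> G. fst e \<notin> {2..<m + 2} \<and> snd e \<notin> {2..<m + 2}}"
  using assms(2)
proof (induction m)
  case 0
  then show ?case by simp
next
  case (Suc m)
  then have IH: "fold moran_update (map (\<lambda>v. (1, v)) [2..<m + 2]) G
           = (Pair 1 ` {2..<m + 2}) \<union> {e \<in> G. fst e \<notin> {2..<m + 2} \<and> snd e \<notin> {2..<m + 2}}"
    by simp
  have step: "moran_update (1, v) (Pair 1 ` J \<union> {e \<in> G. fst e \<notin> J \<and> snd e \<notin> J})
        = Pair 1 ` insert v J \<union> {e \<in> G. fst e \<notin> insert v J \<and> snd e \<notin> insert v J}"
    if "v \<notin> J" "v \<noteq> 1" for v :: nat and J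
    using that by (auto simp: moran_update_def disconnect_def)
  have upt: "[2..<Suc m + 2] = [2..<m + 2] @ [m + 2]" and I: "{2..<Suc m + 2} = insert (m + 2) {2..<m + 2}"
    by auto
  show ?case
    unfolding upt I map_append fold_append comp_def IH list.map fold_simps
    by (rule step) auto
qed

lemma coalescing_word_complete:
  assumes G: "G \<in> digraphs_on n" and n: "n \<ge> 2"
  shows "fold moran_update (map (\<lambda>v. (1, v)) [2..<n + 1]) G = Pair 1 ` {2..n}"
proof -
  have eq: "n - 1 + 2 = n + 1" using n by simp
  have "{e \<in> G. fst e \<notin> {2..<n + 1} \<and> snd e \<notin> {2..<n + 1}} = {}"
    using G by (fastforce simp: digraphs_on_def ordered_pairs_def)
  moreover have "{2..<n + 1} = {2..n}" by auto
  ultimately show ?thesis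
    using coalescing_word[OF G, of "n - 1"] unfolding eq by (simp only: Un_empty_right)
qed

lemma moran_step_funpow:
  "((\<lambda>p. bind_pmf p (moran_step n)) ^^ m) p =
     bind_pmf p (\<lambda>G. map_pmf (\<lambda>w. fold moran_update w G) (replicate_pmf m (pmf_of_set (ordered_pairs n))))"
proof (induction m arbitrary: p)
  case 0
  then show ?case by (simp add: bind_return_pmf')
next
  case (Suc m)
  show ?case
    unfolding funpow_Suc_right comp_def Suc
    by (simp only: bind_assoc_pmf moran_step_def map_pmf_def bind_return_pmf replicate_pmf.simps
          fold_simps)
qed

lemma moran_stationary_ex1:
  assumes n: "n \<ge> 2"
  shows "\<exists>!p. moran_stationary n p"
proof -
  let ?T = "\<lambda>p. bind_pmf p (moran_step n)"
  let ?S = "Pair (1::nat) ` {2..n}"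
  define w :: "(nat \<times> nat) list" where "w = map (\<lambda>v. (1, v)) [2..<n + 1]"
  define A where "A = replicate_pmf (n - 1) (pmf_of_set (ordered_pairs n))"
  define Q where "Q G = map_pmf (\<lambda>w. fold moran_update w G) (cond_pmf A (- {w}))" for G
  have "(1, 2) \<in> ordered_pairs n" using n by (simp add: ordered_pairs_def)
  then have pne: "ordered_pairs n \<noteq> {}" by blast
  have setA: "set_pmf A = {xs. set xs \<subseteq> ordered_pairs n \<and> length xs = n - 1}"
    using pne by (auto simp: A_def set_replicate_pmf)
  have wA: "w \<in> set_pmf A" using n by (auto simp: setA w_def ordered_pairs_def)
  have "replicate (n - 1) (2, 1) \<in> set_pmf A"
    using n by (auto simp: setA ordered_pairs_def)
  moreover have "replicate (n - 1) (2, 1) \<noteq> w"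
  proof
    assume "replicate (n - 1) (2, 1) = w"
    then have "(2, 1) \<in> set w" using n by (metis in_set_replicate diff_is_0_eq not_less_eq_eq
        One_nat_def numeral_2_eq_2)
    then show False by (auto simp: w_def)
  qed
  ultimately have ne: "set_pmf A \<inter> (- {w}) \<noteq> {}" by blast
  let ?d = "pmf A w"
  have d0: "?d > 0" using wA by (simp add: pmf_positive)
  have "measure_pmf.prob A (- {w}) > 0"
    using ne by (metis Int_emptyI disjoint_iff measure_pmf_posI)
  then have d1: "?d < 1"
    using measure_pmf.prob_compl[of "{w}" A] by (simp add: Compl_eq_Diff_UNIV measure_pmf_single)
  define R where "R p = bind_pmf (bernoulli_pmf ?d) (\<lambda>b. if b then return_pmf ?S else bind_pmf p Q)"
    for p
  define g where "g = bind_pmf (geometric_pmf ?d) (\<lambda>k. ((\<lambda>p. bind_pmf p Q) ^^ k) (return_pmf ?S))"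
  have Rfix: "R p = p \<longleftrightarrow> p = g" for p
    unfolding R_def g_def by (rule mixture_stationary_iff[OF d0 d1])
  have TR: "(?T ^^ (n - 1)) p = R p" if p: "set_pmf p \<subseteq> digraphs_on n" for p
  proof -
    have "(?T ^^ (n - 1)) p = bind_pmf p (\<lambda>G. map_pmf (\<lambda>w. fold moran_update w G) A)"
      unfolding moran_step_funpow A_def ..
    also have "\<dots> = bind_pmf p (\<lambda>G. bind_pmf (bernoulli_pmf ?d) (\<lambda>b. if b then return_pmf ?S else Q G))"
    proof (rule bind_pmf_cong)
      fix G assume "G \<in> set_pmf p"
      then have "fold moran_update w G = ?S"
        using coalescing_word_complete[of G n] n p by (auto simp: w_def)
      then show "map_pmf (\<lambda>w. fold moran_update w G) A =
                   bind_pmf (bernoulli_pmf ?d) (\<lambda>b. if b then return_pmf ?S else Q G)"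
        by (subst pmf_split_atom[OF wA ne])
           (auto simp: map_bind_pmf Q_def intro!: bind_pmf_cong)
    qed simp
    also have "\<dots> = R p"
      unfolding R_def by (subst bind_commute_pmf) (auto intro!: bind_pmf_cong)
    finally show ?thesis .
  qed
  have S: "?S \<in> digraphs_on n" using n by (auto simp: digraphs_on_def ordered_pairs_def)
  have Qin: "set_pmf (Q G) \<subseteq> digraphs_on n" if "G \<in> digraphs_on n" for G
    using that by (auto simp: Q_def ne set_cond_pmf[OF ne] setA intro!: fold_moran_update_digraphs_on)
  have "set_pmf (((\<lambda>p. bind_pmf p Q) ^^ k) (return_pmf ?S)) \<subseteq> digraphs_on n" for k
    by (induction k) (use S Qin in auto)
  then have gin: "set_pmf g \<subseteq> digraphs_on n" by (auto simp: g_def)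
  have Tin: "set_pmf (?T p) \<subseteq> digraphs_on n" if "set_pmf p \<subseteq> digraphs_on n" for p
    using that pne by (auto simp: moran_step_def intro!: moran_update_digraphs_on)
  have "R (?T g) = (?T ^^ (n - 1)) (?T g)" using TR[OF Tin[OF gin]] by simp
  also have "\<dots> = ?T ((?T ^^ (n - 1)) g)" by (rule funpow_swap1[symmetric])
  also have "(?T ^^ (n - 1)) g = g" using TR[OF gin] Rfix by simp
  finally have "?T g = g" using Rfix by simp
  then have "moran_stationary n g" using gin by (simp add: moran_stationary_def)
  moreover have "p = g" if "moran_stationary n p" for p
  proof -
    have "(?T ^^ k) p = p" for k
      using that by (induction k) (auto simp: moran_stationary_def)
    then have "R p = p" using TR[of p] that by (simp add: moran_stationary_def)
    then show ?thesis using Rfix by simp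
  qed
  ultimately show ?thesis by blast
qed

end

theory Submission
  imports Defs "HOL-Real_Asymp.Real_Asymp"
begin

text \<open>
  Looking backwards in time, a graph drawn from the stationary distribution is determined by the last
  update of each vertex. The order in which the vertices were last updated is a uniform permutation,
  the parent that a vertex received is uniform among the other vertices, and all these choices are
  independent. The edge from a parent to its child is present exactly if the parent is older in this
  order. This description of the Moran forest is \<open>moran_forest_eq_genealogy_pmf\<close>: the law it defines
  is stationary, because an update moves the vertex to the recent end of the order and resamples its
  parent.

  Consequently a vertex has at most one incoming edge, and its number of outgoing edges behaves
  roughly like a count of rare events with bounded mean: it exceeds \<open>k\<close> with a probability that is
  \<open>1 / fact k\<close> up to a factor exponential in \<open>k\<close>. For the upper bound \<open>max_degree_upper_tail\<close> every
  vertex that chose \<open>v\<close> as its parent is counted, and the order is ignored. For the lower bound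
  \<open>max_degree_lower_tail\<close> only edges from the older half to the recent half of the vertices are
  counted: they are present for every order within the halves, and the counts for different vertices
  of the older half are nearly uncorrelated, so that the second moment method applies.

  The largest of \<open>n\<close> such degrees is therefore close to the solution \<open>k\<close> of \<open>k * ln k + O(k) = ln n\<close>.
  The factors exponential in \<open>k\<close> enter only through the \<open>O(k)\<close>, which shifts the solution by
  \<open>O(ln n / (ln (ln n))\<^sup>2)\<close>. This is of smaller order than
  \<open>ln n * ln (ln (ln n)) / (ln (ln n))\<^sup>2\<close>, the scale on which the theorem describes the maximal
  degree.
\<close>

section \<open>Preimage counts of random functions\<close>

text \<open>
  Chebyshev's argument for the number \<open>X\<close> of events that occur, whose mean is \<open>card H * P\<close>: if \<open>X\<close>
  vanishes then \<open>X\<close> deviates from its mean by the whole mean, and the variance is at most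
  \<open>mean + (c - 1) * mean\<^sup>2\<close>. The bound is useful when the mean is large and the events are nearly
  uncorrelated, that is, when \<open>c\<close> is close to \<open>1\<close>.
\<close>

lemma (in prob_space) second_moment_none_occurs:
  fixes E :: "'i \<Rightarrow> 'a set" and P c :: real
  assumes fin: "finite H" and ne: "H \<noteq> {}" and P: "P > 0" and c: "c \<ge> 0"
    and meas: "\<And>v. v \<in> H \<Longrightarrow> E v \<in> events"
    and single: "\<And>v. v \<in> H \<Longrightarrow> prob (E v) = P"
    and pair: "\<And>u v. u \<in> H \<Longrightarrow> v \<in> H \<Longrightarrow> u \<noteq> v \<Longrightarrow> prob (E u \<inter> E v) \<le> c * P\<^sup>2"
  shows "prob {x \<in> space M. \<forall>v\<in>H. x \<notin> E v} \<le> 1 / (card H * P) + c - 1"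
proof -
  define h where "h = real (card H)"
  have h: "h > 0" using fin ne by (simp add: h_def card_gt_0_iff)
  define X where "X x = (\<Sum>v\<in>H. indicator (E v) x :: real)" for x
  have int1: "integrable M (\<lambda>x. indicator (E v) x :: real)" if "v \<in> H" for v
    using meas[OF that] by (auto intro!: integrable_real_indicator simp: emeasure_eq_measure)
  have int2: "integrable M (\<lambda>x. indicator (E u \<inter> E v) x :: real)" if "u \<in> H" "v \<in> H" for u v
    using meas[OF that(1)] meas[OF that(2)]
    by (auto intro!: integrable_real_indicator simp: emeasure_eq_measure)
  have sq: "(X x - h * P)\<^sup>2 = (\<Sum>u\<in>H. \<Sum>v\<in>H. indicator (E u \<inter> E v) x)
      - 2 * (h * P) * (\<Sum>v\<in>H. indicator (E v) x) + (h * P)\<^sup>2" for x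
  proof -
    have "(X x)\<^sup>2 = (\<Sum>u\<in>H. \<Sum>v\<in>H. indicator (E u \<inter> E v) x)"
      by (simp add: X_def power2_eq_square sum_product indicator_inter_arith)
    then show ?thesis by (simp add: power2_diff flip: X_def)
  qed
  have intX: "integrable M (\<lambda>x. (X x - h * P)\<^sup>2)"
    unfolding sq
    by (intro Bochner_Integration.integrable_add Bochner_Integration.integrable_diff
        Bochner_Integration.integrable_sum integrable_mult_right int1 int2) auto
  have row: "(\<Sum>v\<in>H. prob (E u \<inter> E v)) \<le> P + h * (c * P\<^sup>2)" if u: "u \<in> H" for u
  proof -
    have "(\<Sum>v\<in>H. prob (E u \<inter> E v)) = prob (E u \<inter> E u) + (\<Sum>v\<in>H - {u}. prob (E u \<inter> E v))"
      using fin u by (rule sum.remove)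
    also have "\<dots> \<le> P + (\<Sum>v\<in>H - {u}. c * P\<^sup>2)"
      using u by (intro add_mono sum_mono pair) (auto simp: single)
    also have "\<dots> \<le> P + h * (c * P\<^sup>2)"
      unfolding sum_constant h_def using c fin
      by (intro add_left_mono mult_right_mono) (auto intro!: card_mono)
    finally show ?thesis .
  qed
  have intY: "integrable M (\<lambda>x. \<Sum>u\<in>H. \<Sum>v\<in>H. indicator (E u \<inter> E v) x :: real)"
    by (intro Bochner_Integration.integrable_sum int2)
  have intZ: "integrable M (\<lambda>x. \<Sum>v\<in>H. indicator (E v) x :: real)"
    by (intro Bochner_Integration.integrable_sum int1)
  have "expectation (\<lambda>x. \<Sum>u\<in>H. \<Sum>v\<in>H. indicator (E u \<inter> E v) x :: real) =
      (\<Sum>u\<in>H. expectation (\<lambda>x. \<Sum>v\<in>H. indicator (E u \<inter> E v) x))"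
    by (intro Bochner_Integration.integral_sum Bochner_Integration.integrable_sum int2)
  also have "\<dots> = (\<Sum>u\<in>H. \<Sum>v\<in>H. expectation (\<lambda>x. indicator (E u \<inter> E v) x))"
    by (intro sum.cong refl Bochner_Integration.integral_sum int2)
  also have "\<dots> = (\<Sum>u\<in>H. \<Sum>v\<in>H. prob (E u \<inter> E v))"
    using meas by (intro sum.cong refl) (simp add: Int_absorb1 sets.sets_into_space sets.Int)
  finally have eY: "expectation (\<lambda>x. \<Sum>u\<in>H. \<Sum>v\<in>H. indicator (E u \<inter> E v) x :: real) =
      (\<Sum>u\<in>H. \<Sum>v\<in>H. prob (E u \<inter> E v))" .
  have "expectation (\<lambda>x. \<Sum>v\<in>H. indicator (E v) x :: real) =
      (\<Sum>v\<in>H. expectation (\<lambda>x. indicator (E v) x))"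
    by (intro Bochner_Integration.integral_sum int1)
  also have "\<dots> = (\<Sum>v\<in>H. prob (E v))"
    using meas by (intro sum.cong refl) (simp add: Int_absorb1 sets.sets_into_space)
  finally have eZ: "expectation (\<lambda>x. \<Sum>v\<in>H. indicator (E v) x :: real) = (\<Sum>v\<in>H. prob (E v))" .
  have "expectation (\<lambda>x. (X x - h * P)\<^sup>2) =
      expectation (\<lambda>x. (\<Sum>u\<in>H. \<Sum>v\<in>H. indicator (E u \<inter> E v) x)
        - 2 * (h * P) * (\<Sum>v\<in>H. indicator (E v) x)) + expectation (\<lambda>_. (h * P)\<^sup>2)"
    unfolding sq
    by (intro Bochner_Integration.integral_add Bochner_Integration.integrable_diff
        integrable_mult_right intY intZ) auto
  also have "expectation (\<lambda>x. (\<Sum>u\<in>H. \<Sum>v\<in>H. indicator (E u \<inter> E v) x)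
        - 2 * (h * P) * (\<Sum>v\<in>H. indicator (E v) x))
      = expectation (\<lambda>x. \<Sum>u\<in>H. \<Sum>v\<in>H. indicator (E u \<inter> E v) x)
        - expectation (\<lambda>x. 2 * (h * P) * (\<Sum>v\<in>H. indicator (E v) x))"
    by (intro Bochner_Integration.integral_diff integrable_mult_right intY intZ)
  also have "expectation (\<lambda>x. 2 * (h * P) * (\<Sum>v\<in>H. indicator (E v) x)) =
      2 * (h * P) * (\<Sum>v\<in>H. prob (E v))"
    unfolding integral_mult_right_zero eZ ..
  also have "expectation (\<lambda>_. (h * P)\<^sup>2) = (h * P)\<^sup>2" by (simp add: prob_space)
  finally have "expectation (\<lambda>x. (X x - h * P)\<^sup>2) =
      (\<Sum>u\<in>H. \<Sum>v\<in>H. prob (E u \<inter> E v)) - 2 * (h * P) * (\<Sum>v\<in>H. prob (E v)) + (h * P)\<^sup>2"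
    unfolding eY .
  also have "(\<Sum>v\<in>H. prob (E v)) = h * P" by (simp add: single h_def)
  also have "(\<Sum>u\<in>H. \<Sum>v\<in>H. prob (E u \<inter> E v)) \<le> h * (P + h * (c * P\<^sup>2))"
    unfolding h_def using sum_mono[of H, OF row] by (simp add: h_def)
  finally have var: "expectation (\<lambda>x. (X x - h * P)\<^sup>2) \<le> h * P + (h * P)\<^sup>2 * (c - 1)"
    by (simp add: algebra_simps power2_eq_square)
  let ?N = "{x \<in> space M. \<forall>v\<in>H. x \<notin> E v}"
  have "prob ?N \<le> prob {x \<in> space M. (X x - h * P)\<^sup>2 \<ge> (h * P)\<^sup>2}"
    using intX by (intro finite_measure_mono) (auto simp: X_def)
  also have "\<dots> \<le> expectation (\<lambda>x. (X x - h * P)\<^sup>2) / (h * P)\<^sup>2"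
    using h P by (intro integral_Markov_inequality_measure[where A = "{}"] intX) auto
  also have "\<dots> \<le> (h * P + (h * P)\<^sup>2 * (c - 1)) / (h * P)\<^sup>2"
    using var by (intro divide_right_mono) auto
  also have "\<dots> = 1 / (h * P) + c - 1"
    using h P by (simp add: field_simps power2_eq_square)
  finally show ?thesis by (simp add: h_def)
qed

lemma prob_Pi_pmf_cylinder:
  assumes "finite A" "W \<subseteq> A"
  shows "measure_pmf.prob (Pi_pmf A d p) {f. \<forall>w\<in>W. f w \<in> B w} =
    (\<Prod>w\<in>W. measure_pmf.prob (p w) (B w))"
proof -
  have "{f. \<forall>w\<in>W. f w \<in> B w} = Pi A (\<lambda>w. if w \<in> W then B w else UNIV)"
    using assms(2) by (auto simp: Pi_def)
  then have "measure_pmf.prob (Pi_pmf A d p) {f. \<forall>w\<in>W. f w \<in> B w} =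
     (\<Prod>w\<in>A. measure_pmf.prob (p w) (if w \<in> W then B w else UNIV))"
    using measure_Pi_pmf_Pi[OF assms(1)] by simp
  also have "\<dots> = (\<Prod>w\<in>W. measure_pmf.prob (p w) (B w))"
    using assms by (intro prod.mono_neutral_cong_right) auto
  finally show ?thesis .
qed

text \<open>
  A union bound over the \<open>m\<close>-element sets of arguments that could all be mapped to \<open>v\<close>.
\<close>

lemma prob_many_preimages_le:
  fixes q :: real
  assumes "finite A" "W \<subseteq> A" "\<And>w. w \<in> W \<Longrightarrow> pmf (p w) v \<le> q" "q \<ge> 0"
  shows "measure_pmf.prob (Pi_pmf A d p) {f. m \<le> card {w \<in> W. f w = v}} \<le> (card W * q) ^ m / fact m"
proof -
  have W: "finite W" using assms finite_subset by blast
  let ?S = "{S. S \<subseteq> W \<and> card S = m}"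
  let ?E = "\<lambda>S. {f. \<forall>w\<in>S. f w \<in> {v}}"
  have finS: "finite ?S" using W by auto
  have q: "q ^ m \<ge> 0" using assms by simp
  have "measure_pmf.prob (Pi_pmf A d p) {f. m \<le> card {w \<in> W. f w = v}}
      \<le> measure_pmf.prob (Pi_pmf A d p) (\<Union>S\<in>?S. ?E S)"
  proof (intro measure_pmf.finite_measure_mono subsetI)
    fix f assume "f \<in> {f. m \<le> card {w \<in> W. f w = v}}"
    then obtain S where "S \<subseteq> {w \<in> W. f w = v}" "card S = m"
      using obtain_subset_with_card_n by blast
    then show "f \<in> (\<Union>S\<in>?S. ?E S)" by blast
  qed simp
  also have "\<dots> \<le> (\<Sum>S\<in>?S. measure_pmf.prob (Pi_pmf A d p) (?E S))"
    using finS by (intro measure_pmf.finite_measure_subadditive_finite) auto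
  also have "\<dots> \<le> (\<Sum>S\<in>?S. q ^ m)"
  proof (intro sum_mono)
    fix S assume S: "S \<in> ?S"
    then have "measure_pmf.prob (Pi_pmf A d p) (?E S) = (\<Prod>w\<in>S. pmf (p w) v)"
      using assms(2) by (subst prob_Pi_pmf_cylinder[OF assms(1)]) (auto simp: measure_pmf_single)
    also have "\<dots> \<le> (\<Prod>w\<in>S. q)" using S assms(3) by (intro prod_mono) auto
    finally show "measure_pmf.prob (Pi_pmf A d p) (?E S) \<le> q ^ m" using S by simp
  qed
  also have "\<dots> = (card W choose m) * q ^ m" using n_subsets[OF W, of m] by simp
  also have "\<dots> \<le> (card W ^ m / fact m) * q ^ m"
  proof (intro mult_right_mono q)
    have "real ((card W choose m) * fact m) \<le> real (card W ^ m)"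
      using binomial_fact_pow[of "card W" m] by (simp only: of_nat_le_iff)
    then show "real (card W choose m) \<le> card W ^ m / fact m" by (simp add: field_simps)
  qed
  finally show ?thesis by (simp add: power_mult_distrib)
qed

lemma prob_preimage_card_eq:
  fixes q :: real
  assumes A: "finite A" and WA: "W \<subseteq> A" and q: "\<And>w. w \<in> W \<Longrightarrow> pmf (p w) v = q"
  shows "measure_pmf.prob (Pi_pmf A d p) {f. card {w \<in> W. f w = v} = k} =
    (card W choose k) * q ^ k * (1 - q) ^ (card W - k)"
proof -
  have W: "finite W" using assms finite_subset by blast
  let ?S = "{S. S \<subseteq> W \<and> card S = k}"
  let ?E = "\<lambda>S. {f. \<forall>w\<in>W. f w \<in> (if w \<in> S then {v} else - {v})}"
  have finS: "finite ?S" using W by auto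
  have E: "f \<in> ?E S \<longleftrightarrow> {w \<in> W. f w = v} = S" if "S \<in> ?S" for f S
    using that by (auto split: if_splits)
  have "{f. card {w \<in> W. f w = v} = k} = (\<Union>S\<in>?S. ?E S)"
  proof (intro set_eqI iffI)
    fix f assume "f \<in> {f. card {w \<in> W. f w = v} = k}"
    then have S: "{w \<in> W. f w = v} \<in> ?S" by auto
    with E[OF S, of f] show "f \<in> (\<Union>S\<in>?S. ?E S)" by blast
  next
    fix f assume "f \<in> (\<Union>S\<in>?S. ?E S)"
    then obtain S where "S \<in> ?S" "f \<in> ?E S" by blast
    with E[of S f] show "f \<in> {f. card {w \<in> W. f w = v} = k}" by simp
  qed
  moreover have "disjoint_family_on ?E ?S"
    unfolding disjoint_family_on_def
  proof (intro ballI impI)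
    fix S T assume "S \<in> ?S" "T \<in> ?S" "S \<noteq> T"
    then have "f \<notin> ?E S \<inter> ?E T" for f using E[of S f] E[of T f] by simp
    then show "?E S \<inter> ?E T = {}" by blast
  qed
  ultimately have "measure_pmf.prob (Pi_pmf A d p) {f. card {w \<in> W. f w = v} = k} =
     (\<Sum>S\<in>?S. measure_pmf.prob (Pi_pmf A d p) (?E S))"
    using finS by (simp add: measure_pmf.finite_measure_finite_Union)
  also have "\<dots> = (\<Sum>S\<in>?S. q ^ k * (1 - q) ^ (card W - k))"
  proof (intro sum.cong refl)
    fix S assume S: "S \<in> ?S"
    have "measure_pmf.prob (Pi_pmf A d p) (?E S) = (\<Prod>w\<in>W. if w \<in> S then q else 1 - q)"
      using q by (subst prob_Pi_pmf_cylinder[OF A WA])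
        (auto simp: measure_pmf_single Compl_eq_Diff_UNIV measure_pmf.prob_compl[of "{v}", simplified] intro!: prod.cong)
    also have "\<dots> = (\<Prod>w\<in>W \<inter> S. q) * (\<Prod>w\<in>W - S. 1 - q)"
      using W by (simp add: prod.If_cases Diff_eq)
    also have "W \<inter> S = S" using S by blast
    finally have "measure_pmf.prob (Pi_pmf A d p) (?E S) = (\<Prod>w\<in>S. q) * (\<Prod>w\<in>W - S. 1 - q)" .
    moreover have "card (W - S) = card W - k"
      using S W card_Diff_subset[of S W] finite_subset[of S W] by simp
    ultimately show "measure_pmf.prob (Pi_pmf A d p) (?E S) = q ^ k * (1 - q) ^ (card W - k)"
      using S by simp
  qed
  also have "\<dots> = (card W choose k) * q ^ k * (1 - q) ^ (card W - k)"
    using n_subsets[OF W, of k] by simp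
  finally show ?thesis .
qed

text \<open>
  The preimages of two values are disjoint, so that the exact probability is a multinomial one. Two
  estimates bring it close to the product of two binomial probabilities: dropping the disjointness
  when counting pairs of \<open>k\<close>-sets, and \<open>1 - 2 * q \<le> (1 - q)\<^sup>2\<close>. Only the exponent of \<open>1 - q\<close>
  differs from that of the product, and the difference is harmless when \<open>k * q\<close> is small.
\<close>

lemma prob_two_preimages_card_eq_le:
  fixes q :: real
  assumes A: "finite A" and WA: "W \<subseteq> A" and uv: "u \<noteq> v"
    and qu: "\<And>w. w \<in> W \<Longrightarrow> pmf (p w) u = q"
    and qv: "\<And>w. w \<in> W \<Longrightarrow> pmf (p w) v = q"
  shows "measure_pmf.prob (Pi_pmf A d p)
      {f. card {w \<in> W. f w = u} = k \<and> card {w \<in> W. f w = v} = k}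
    \<le> (card W choose k)\<^sup>2 * q ^ (2 * k) * (1 - q) ^ (2 * (card W - 2 * k))"
proof -
  have W: "finite W" using assms finite_subset by blast
  let ?S = "{S. S \<subseteq> W \<and> card S = k}"
  let ?I = "{(S, T). S \<in> ?S \<and> T \<in> ?S \<and> S \<inter> T = {}}"
  let ?E = "\<lambda>(S, T). {f. \<forall>w\<in>W. f w \<in> (if w \<in> S then {u} else if w \<in> T then {v} else - {u, v})}"
  have finS: "finite ?S" using W by auto
  have I: "?I \<subseteq> ?S \<times> ?S" by auto
  have finI: "finite ?I" using finite_subset[OF I] finS by blast
  have "measure_pmf.prob (Pi_pmf A d p)
      {f. card {w \<in> W. f w = u} = k \<and> card {w \<in> W. f w = v} = k}
    \<le> measure_pmf.prob (Pi_pmf A d p) (\<Union>I\<in>?I. ?E I)"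
  proof (intro measure_pmf.finite_measure_mono subsetI)
    fix f assume f: "f \<in> {f. card {w \<in> W. f w = u} = k \<and> card {w \<in> W. f w = v} = k}"
    let ?J = "({w \<in> W. f w = u}, {w \<in> W. f w = v})"
    have "?J \<in> ?I" using f uv by auto
    moreover have "f \<in> ?E ?J" by auto
    ultimately show "f \<in> (\<Union>I\<in>?I. ?E I)" by blast
  qed simp
  also have "\<dots> \<le> (\<Sum>I\<in>?I. measure_pmf.prob (Pi_pmf A d p) (?E I))"
    using finI by (intro measure_pmf.finite_measure_subadditive_finite) auto
  also have "\<dots> \<le> (\<Sum>I\<in>?I. q ^ (2 * k) * (1 - q) ^ (2 * (card W - 2 * k)))"
  proof (intro sum_mono)
    fix I assume "I \<in> ?I"
    then obtain S T where I: "I = (S, T)" and S: "S \<subseteq> W" "card S = k"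
      and T: "T \<subseteq> W" "card T = k" and ST: "S \<inter> T = {}" by blast
    have finST: "finite S" "finite T" using S T W finite_subset by blast+
    have cST: "card (S \<union> T) = 2 * k"
      using card_Un_disjoint[OF finST ST] S T by simp
    have "card (W - (S \<union> T)) = card W - card (S \<union> T)"
      using S(1) T(1) finST by (intro card_Diff_subset) auto
    with cST have cD: "card (W - (S \<union> T)) = card W - 2 * k" by simp
    have pr: "measure_pmf.prob (p w) (- {u, v}) = 1 - 2 * q" if "w \<in> W" for w
    proof -
      have "measure_pmf.prob (p w) {u, v} = 2 * q"
        using qu[OF that] qv[OF that] uv by (simp add: measure_measure_pmf_finite)
      then show ?thesis
        using measure_pmf.prob_compl[of "{u, v}" "p w"] by (simp add: Compl_eq_Diff_UNIV)
    qed
    have nonneg: "0 \<le> 1 - 2 * q" if "W \<noteq> {}"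
      using that pr by (metis all_not_in_conv measure_nonneg)
    have le: "1 - 2 * q \<le> (1 - q)\<^sup>2" by (simp add: power2_diff)
    have "measure_pmf.prob (Pi_pmf A d p) (?E I) =
        (\<Prod>w\<in>W. if w \<in> S \<union> T then q else 1 - 2 * q)"
      unfolding I prod.case using qu qv pr
      by (subst prob_Pi_pmf_cylinder[OF A WA]) (auto simp: measure_pmf_single intro!: prod.cong)
    also have "\<dots> = (\<Prod>w\<in>W \<inter> (S \<union> T). q) * (\<Prod>w\<in>W - (S \<union> T). 1 - 2 * q)"
      using prod.If_cases[OF W, of "\<lambda>w. w \<in> S \<union> T" "\<lambda>_. q" "\<lambda>_. 1 - 2 * q"]
      by (simp only: Collect_mem_eq Diff_eq)
    also have "W \<inter> (S \<union> T) = S \<union> T" using S T by blast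
    also have "(\<Prod>w\<in>S \<union> T. q) = q ^ (2 * k)"
      by (simp add: cST)
    also have "(\<Prod>w\<in>W - (S \<union> T). 1 - 2 * q) = (1 - 2 * q) ^ (card W - 2 * k)"
      by (simp add: cD)
    also have "\<dots> \<le> (1 - q) ^ (2 * (card W - 2 * k))"
    proof (cases "W = {}")
      case False
      then show ?thesis unfolding power_mult using nonneg le by (intro power_mono) auto
    qed simp
    finally show "measure_pmf.prob (Pi_pmf A d p) (?E I) \<le>
        q ^ (2 * k) * (1 - q) ^ (2 * (card W - 2 * k))"
      by (simp add: mult_left_mono)
  qed
  also have "\<dots> \<le> (card W choose k)\<^sup>2 * (q ^ (2 * k) * (1 - q) ^ (2 * (card W - 2 * k)))"
  proof -
    have "card ?I \<le> (card W choose k)\<^sup>2"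
      using card_mono[OF _ I] finS n_subsets[OF W, of k] by (simp add: power2_eq_square)
    then have "real (card ?I) \<le> real ((card W choose k)\<^sup>2)" by (rule of_nat_mono)
    then show ?thesis unfolding sum_constant
      by (intro mult_right_mono) auto
  qed
  finally show ?thesis by (simp add: mult.assoc)
qed

section \<open>The stationary law as a random genealogy\<close>

text \<open>
  The list enumerates the vertices by the time of their last update, the most recent first, and
  \<open>f v\<close> is the vertex to which \<open>v\<close> was attached at that time. The edge from \<open>f v\<close> to \<open>v\<close> is still
  present exactly if \<open>f v\<close> has not been updated since, that is, if \<open>f v\<close> occurs later in the list.
\<close>

fun genealogy :: "(nat \<Rightarrow> nat) \<Rightarrow> nat list \<Rightarrow> digraph" where
  "genealogy f [] = {}"
| "genealogy f (v # vs) = (if f v \<in> set vs then insert (f v, v) else id) (genealogy f vs)"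

lemma genealogy_cong:
  assumes "\<And>v. v \<in> set vs \<Longrightarrow> f v = g v"
  shows "genealogy f vs = genealogy g vs"
  using assms by (induction vs) auto

lemma genealogy_subset: "genealogy f vs \<subseteq> {(f w, w) | w. w \<in> set vs \<and> f w \<in> set vs}"
  by (induction vs) auto

lemma genealogy_irrefl: "distinct vs \<Longrightarrow> (w, w) \<notin> genealogy f vs"
  by (induction vs) auto

lemma genealogy_older_half:
  assumes "w \<in> set vs" "f w \<in> set us"
  shows "(f w, w) \<in> genealogy f (vs @ us)"
  using assms by (induction vs) auto

text \<open>
  The edges between the other vertices depend only on the relative order of these vertices.
\<close>

lemma disconnect_genealogy:
  "disconnect v (genealogy f vs) = genealogy f (filter (\<lambda>w. w \<noteq> v) vs)"
proof (induction vs)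
  case Nil
  then show ?case by (simp add: disconnect_def)
next
  case (Cons w vs)
  have drop: "disconnect v (insert e G) = disconnect v G" if "fst e = v \<or> snd e = v" for e G
    using that by (auto simp: disconnect_def)
  have keep: "disconnect v (insert e G) = insert e (disconnect v G)"
    if "fst e \<noteq> v" "snd e \<noteq> v" for e G
    using that by (auto simp: disconnect_def)
  consider "w = v" | "w \<noteq> v" "f w = v" | "w \<noteq> v" "f w \<noteq> v" by blast
  then show ?case
    by cases (simp_all add: Cons drop keep)
qed

text \<open>
  A step of the Moran chain lifts to a move of \<open>v\<close> to the front and a change of its parent: as the
  most recently updated vertex, \<open>v\<close> has no children left, and its new parent is older.
\<close>

lemma moran_update_genealogy:
  assumes "u \<in> set vs" "u \<noteq> v"
  shows "moran_update (u, v) (genealogy f vs) =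
    genealogy (f(v := u)) (v # filter (\<lambda>w. w \<noteq> v) vs)"
proof -
  have "genealogy (f(v := u)) (filter (\<lambda>w. w \<noteq> v) vs) = genealogy f (filter (\<lambda>w. w \<noteq> v) vs)"
    by (rule genealogy_cong) auto
  then show ?thesis
    using assms by (simp add: moran_update_def disconnect_genealogy)
qed

definition parent_pmf :: "'a set \<Rightarrow> ('a \<Rightarrow> 'a) pmf" where
  "parent_pmf A = Pi_pmf A undefined (\<lambda>v. pmf_of_set (A - {v}))"

lemma resample_Pi_pmf:
  assumes "finite A" "v \<in> A"
  shows "bind_pmf (p v) (\<lambda>u. map_pmf (\<lambda>f. f(v := u)) (Pi_pmf A d p)) = Pi_pmf A d p"
proof -
  have A: "A = insert v (A - {v})" using assms by auto
  have fin: "finite (A - {v})" using assms by auto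
  note ins = Pi_pmf_insert'[OF fin, of v d p, folded A]
  show ?thesis
    unfolding ins
    by (simp add: map_bind_pmf map_pmf_def bind_assoc_pmf bind_return_pmf ins)
qed

lemma filter_random_permutation:
  assumes "finite A"
  shows "map_pmf (filter P) (pmf_of_set (permutations_of_set A)) =
    pmf_of_set (permutations_of_set {x \<in> A. P x})"
proof -
  have "map_pmf (filter P) (pmf_of_set (permutations_of_set A)) =
      map_pmf fst (map_pmf (partition P) (pmf_of_set (permutations_of_set A)))"
    by (simp add: map_pmf_comp)
  also have "\<dots> = pmf_of_set (permutations_of_set {x \<in> A. P x})"
    by (simp add: partition_random_permutations[OF assms] map_fst_pair_pmf)
  finally show ?thesis .
qed

lemma pmf_of_set_ordered_pairs:
  assumes "n \<ge> 2"
  shows "pmf_of_set (ordered_pairs n) =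
    bind_pmf (pmf_of_set {1..n}) (\<lambda>v. map_pmf (\<lambda>u. (u, v)) (pmf_of_set ({1..n} - {v})))"
    (is "_ = ?r")
proof (rule pmf_eqI)
  fix e :: "nat \<times> nat"
  obtain a b where e: "e = (a, b)" by force
  define A where "A = {1..n}"
  have fin: "finite A" and cardA: "card A = n" by (auto simp: A_def)
  have cardm: "card (A - {v}) = n - 1" if "v \<in> A" for v
    using that fin cardA by simp
  have ne: "A - {v} \<noteq> {}" if "v \<in> A" for v
    using cardm[OF that] assms by fastforce
  have op: "ordered_pairs n = (SIGMA v:A. A - {v})" by (auto simp: ordered_pairs_def A_def)
  have c: "card (ordered_pairs n) = n * (n - 1)"
    unfolding op using cardm cardA fin by (simp add: card_SigmaI)
  then have "ordered_pairs n \<noteq> {}" using assms by fastforce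
  then have l: "pmf (pmf_of_set (ordered_pairs n)) e =
      indicator (ordered_pairs n) e / real (n * (n - 1))" by (simp add: c)
  have "pmf (map_pmf (\<lambda>u. (u, v)) (pmf_of_set (A - {v}))) e
      = (if v = b then pmf (pmf_of_set (A - {b})) a else 0)" for v
  proof (cases "v = b")
    case True
    have "inj (\<lambda>u. (u, b))" by (auto simp: inj_on_def)
    from pmf_map_inj'[OF this, of "pmf_of_set (A - {b})" a] show ?thesis
      using True by (simp only: e if_True refl simp_thms)
  next
    case False
    then have "e \<notin> set_pmf (map_pmf (\<lambda>u. (u, v)) (pmf_of_set (A - {v})))" using e by auto
    then show ?thesis using False by (simp add: pmf_eq_0_set_pmf)
  qed
  then have "pmf ?r e = (\<Sum>v\<in>A. (if v = b then pmf (pmf_of_set (A - {b})) a else 0)) / n"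
    using assms fin cardA unfolding A_def[symmetric]
    by (subst pmf_bind, subst integral_pmf_of_set) auto
  also have "\<dots> = (if b \<in> A then pmf (pmf_of_set (A - {b})) a else 0) / n"
    using fin by (simp add: sum.delta)
  also have "\<dots> = indicator (ordered_pairs n) e / real (n * (n - 1))"
    using ne[of b] fin cardm[of b] by (auto simp: op e indicator_def pmf_of_set split: if_splits)
  finally show "pmf (pmf_of_set (ordered_pairs n)) e = pmf ?r e" using l by simp
qed

definition genealogy_pmf :: "nat \<Rightarrow> digraph pmf" where
  "genealogy_pmf n = bind_pmf (pmf_of_set (permutations_of_set {1..n}))
     (\<lambda>vs. map_pmf (\<lambda>f. genealogy f vs) (parent_pmf {1..n}))"

text \<open>
  Lifted to pairs of an update order and a parent function, the chain preserves the uniform law: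
  resampling one parent keeps the parents independent and uniform, and the order of the vertices
  other than \<open>v\<close> is a uniform permutation of them, so that putting a uniformly chosen \<open>v\<close> in front
  restores a uniform permutation. The law of the genealogy is therefore stationary for the Moran
  chain, and uniqueness identifies it with the Moran forest.
\<close>

lemma moran_forest_eq_genealogy_pmf:
  assumes "n \<ge> 2"
  shows "moran_forest n = genealogy_pmf n"
proof -
  let ?A = "{1..n}"
  let ?\<sigma> = "\<lambda>A. pmf_of_set (permutations_of_set A)"
  let ?\<pi> = "parent_pmf ?A"
  have ne: "?A - {v} \<noteq> {}" for v
  proof (cases "v = 1")
    case True then have "2 \<in> ?A - {v}" using assms by auto
    then show ?thesis by blast
  next
    case False then have "1 \<in> ?A - {v}" using assms by auto
    then show ?thesis by blast
  qed
  have A: "?A \<noteq> {}" using assms by auto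
  have "bind_pmf (genealogy_pmf n) (moran_step n) =
     bind_pmf (?\<sigma> ?A) (\<lambda>vs. bind_pmf ?\<pi> (\<lambda>f. bind_pmf (pmf_of_set ?A) (\<lambda>v.
       bind_pmf (pmf_of_set (?A - {v})) (\<lambda>u. return_pmf (moran_update (u, v) (genealogy f vs))))))"
    unfolding genealogy_pmf_def moran_step_def pmf_of_set_ordered_pairs[OF assms]
    by (simp add: map_pmf_def bind_assoc_pmf bind_return_pmf)
  \<comment> \<open>The step acts on the update order and the parent function instead of the graph.\<close>
  also have "\<dots> = bind_pmf (?\<sigma> ?A) (\<lambda>vs. bind_pmf ?\<pi> (\<lambda>f. bind_pmf (pmf_of_set ?A) (\<lambda>v.
       bind_pmf (pmf_of_set (?A - {v})) (\<lambda>u.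
         return_pmf (genealogy (f(v := u)) (v # filter (\<lambda>w. w \<noteq> v) vs))))))"
    using ne A by (intro bind_pmf_cong refl)
      (subst moran_update_genealogy, auto dest: permutations_of_setD)
  also have "\<dots> = bind_pmf (pmf_of_set ?A) (\<lambda>v. bind_pmf (?\<sigma> ?A) (\<lambda>vs.
       bind_pmf (pmf_of_set (?A - {v})) (\<lambda>u. bind_pmf ?\<pi> (\<lambda>f.
         return_pmf (genealogy (f(v := u)) (v # filter (\<lambda>w. w \<noteq> v) vs))))))"
    apply (subst bind_commute_pmf[of ?\<pi>])
    apply (subst bind_commute_pmf[of "?\<sigma> ?A"])
    apply (intro bind_pmf_cong refl)
    apply (rule bind_commute_pmf)
    done
  also have "\<dots> = bind_pmf (pmf_of_set ?A) (\<lambda>v. bind_pmf (?\<sigma> ?A) (\<lambda>vs.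
       bind_pmf ?\<pi> (\<lambda>f. return_pmf (genealogy f (v # filter (\<lambda>w. w \<noteq> v) vs)))))"
  \<comment> \<open>Changing the parent of \<open>v\<close> to a fresh uniform one leaves the law of the parents unchanged.\<close>
  proof (intro bind_pmf_cong refl)
    fix v vs assume "v \<in> set_pmf (pmf_of_set ?A)"
    then have v: "v \<in> ?A" using A by simp
    have "bind_pmf ?\<pi> (\<lambda>f. return_pmf (genealogy f (v # filter (\<lambda>w. w \<noteq> v) vs))) =
      bind_pmf (bind_pmf (pmf_of_set (?A - {v})) (\<lambda>u. map_pmf (\<lambda>f. f(v := u)) ?\<pi>))
        (\<lambda>f. return_pmf (genealogy f (v # filter (\<lambda>w. w \<noteq> v) vs)))"
      using resample_Pi_pmf[of ?A v "\<lambda>v. pmf_of_set (?A - {v})" undefined] v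
      by (simp add: parent_pmf_def)
    then show "bind_pmf (pmf_of_set (?A - {v})) (\<lambda>u. bind_pmf ?\<pi> (\<lambda>f.
         return_pmf (genealogy (f(v := u)) (v # filter (\<lambda>w. w \<noteq> v) vs)))) =
         bind_pmf ?\<pi> (\<lambda>f. return_pmf (genealogy f (v # filter (\<lambda>w. w \<noteq> v) vs)))"
      by (simp add: bind_assoc_pmf map_pmf_def bind_return_pmf)
  qed
  also have "\<dots> = bind_pmf (pmf_of_set ?A) (\<lambda>v.
       bind_pmf (map_pmf (filter (\<lambda>w. w \<noteq> v)) (?\<sigma> ?A)) (\<lambda>vs.
       bind_pmf ?\<pi> (\<lambda>f. return_pmf (genealogy f (v # vs)))))"
    by (simp add: bind_map_pmf)
  also have "\<dots> = bind_pmf (pmf_of_set ?A) (\<lambda>v. bind_pmf (?\<sigma> (?A - {v})) (\<lambda>vs.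
       bind_pmf ?\<pi> (\<lambda>f. return_pmf (genealogy f (v # vs)))))"
    by (simp add: filter_random_permutation set_diff_eq)
  also have "\<dots> = genealogy_pmf n"
    unfolding genealogy_pmf_def
    by (subst (2) random_permutation_of_set)
       (use A in \<open>auto simp: map_pmf_def bind_assoc_pmf bind_return_pmf\<close>)
  finally have "bind_pmf (genealogy_pmf n) (moran_step n) = genealogy_pmf n" .
  moreover have "set_pmf (genealogy_pmf n) \<subseteq> digraphs_on n"
  proof -
    have "genealogy f vs \<in> digraphs_on n" if "vs \<in> permutations_of_set ?A" for f vs
      using genealogy_subset[of f vs] genealogy_irrefl[of vs _ f] permutations_of_setD[OF that]
      by (fastforce simp: digraphs_on_def ordered_pairs_def)
    then show ?thesis by (auto simp: genealogy_pmf_def)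
  qed
  ultimately have "moran_stationary n (genealogy_pmf n)" by (simp add: moran_stationary_def)
  then show ?thesis
    unfolding moran_forest_def using the1_equality[OF moran_stationary_ex1[OF assms]] by blast
qed

section \<open>Tails of the maximal degree\<close>

text \<open>
  All degree estimates below hold conditionally on the update order, whichever it is.
\<close>

lemma prob_genealogy_pmf_le:
  assumes "\<And>vs. vs \<in> permutations_of_set {1..n} \<Longrightarrow>
    measure_pmf.prob (parent_pmf {1..n}) {f. genealogy f vs \<in> S} \<le> c"
  shows "measure_pmf.prob (genealogy_pmf n) S \<le> c"
proof -
  let ?M = "pmf_of_set (permutations_of_set {1..n})"
  obtain vs where "vs \<in> permutations_of_set {1..n}"
    using permutations_of_set_empty_iff[of "{1..n}"] by blast
  then have c: "c \<ge> 0" using assms measure_nonneg order_trans by blast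
  have "emeasure (genealogy_pmf n) S \<le> (\<integral>\<^sup>+vs. ennreal c \<partial>measure_pmf ?M)"
    unfolding genealogy_pmf_def emeasure_bind_pmf
  proof (intro nn_integral_mono_AE AE_pmfI)
    fix vs assume "vs \<in> set_pmf ?M"
    then have "vs \<in> permutations_of_set {1..n}" by simp
    from assms[OF this]
    show "emeasure (map_pmf (\<lambda>f. genealogy f vs) (parent_pmf {1..n})) S \<le> ennreal c"
      by (simp add: measure_pmf.emeasure_eq_measure vimage_def ennreal_leI)
  qed
  also have "\<dots> = ennreal c" by simp
  finally show ?thesis
    using c by (simp add: measure_pmf.emeasure_eq_measure)
qed

lemma pmf_parent:
  assumes "n \<ge> 2" "w \<in> {1..n}" "v \<in> {1..n}" "w \<noteq> v"
  shows "pmf (pmf_of_set ({1..n} - {w})) v = 1 / (real n - 1)"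
proof -
  have "{1..n} - {w} \<noteq> {}" using assms by blast
  then show ?thesis using assms by (simp add: of_nat_diff)
qed

text \<open>
  A vertex has at most one incoming edge, and its outgoing edges lead to vertices that chose it as
  their parent.
\<close>

lemma total_degree_genealogy_le:
  assumes "distinct vs"
  shows "total_degree (genealogy f vs) v \<le> Suc (card {w \<in> set vs - {v}. f w = v})"
proof -
  have sub: "genealogy f vs \<subseteq> (\<lambda>w. (f w, w)) ` set vs" using genealogy_subset[of f vs] by auto
  have "{e \<in> genealogy f vs. snd e = v} \<subseteq> {(f v, v)}" using sub by auto
  then have i: "card {e \<in> genealogy f vs. snd e = v} \<le> 1"
    using card_mono[of "{(f v, v)}"] by simp
  have "{e \<in> genealogy f vs. fst e = v} \<subseteq> Pair v ` {w \<in> set vs - {v}. f w = v}"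
  proof
    fix e assume e: "e \<in> {e \<in> genealogy f vs. fst e = v}"
    then obtain w where w: "e = (f w, w)" "w \<in> set vs" "f w = v" using sub by auto
    moreover have "w \<noteq> v" using e w genealogy_irrefl[OF assms, of v f] by auto
    ultimately show "e \<in> Pair v ` {w \<in> set vs - {v}. f w = v}" by auto
  qed
  then have "card {e \<in> genealogy f vs. fst e = v} \<le> card {w \<in> set vs - {v}. f w = v}"
    by (rule surj_card_le[rotated]) simp
  with i show ?thesis by (simp add: total_degree_def)
qed

text \<open>
  A union bound over the vertices: with \<open>n - 1\<close> potential children, each choosing a given parent with
  probability \<open>1 / (n - 1)\<close>, the bound on the preimage counts is \<open>1 / fact m\<close> for each vertex.
\<close>

lemma max_degree_upper_tail:
  assumes n: "n \<ge> 2"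
  shows "measure_pmf.prob (moran_forest n) {F. Suc m \<le> max_degree n F} \<le> real n / fact m"
  unfolding moran_forest_eq_genealogy_pmf[OF n]
proof (rule prob_genealogy_pmf_le)
  fix vs assume "vs \<in> permutations_of_set {1..n}"
  note vs = permutations_of_setD[OF this]
  let ?N = "\<lambda>v. {f. m \<le> card {w \<in> {1..n} - {v}. f w = v}}"
  have "{f. genealogy f vs \<in> {F. Suc m \<le> max_degree n F}} \<subseteq> (\<Union>v\<in>{1..n}. ?N v)"
  proof
    fix f assume "f \<in> {f. genealogy f vs \<in> {F. Suc m \<le> max_degree n F}}"
    then have "Suc m \<le> Max (total_degree (genealogy f vs) ` {1..n})" by (simp add: max_degree_def)
    then obtain v where "v \<in> {1..n}" "Suc m \<le> total_degree (genealogy f vs) v"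
      using n by (subst (asm) Max_ge_iff) auto
    moreover have "total_degree (genealogy f vs) v \<le> Suc (card {w \<in> {1..n} - {v}. f w = v})"
      using total_degree_genealogy_le[OF vs(2), of f v] unfolding vs(1) .
    ultimately have "m \<le> card {w \<in> {1..n} - {v}. f w = v}" by linarith
    with \<open>v \<in> {1..n}\<close> show "f \<in> (\<Union>v\<in>{1..n}. ?N v)" by blast
  qed
  then have "measure_pmf.prob (parent_pmf {1..n}) {f. genealogy f vs \<in> {F. Suc m \<le> max_degree n F}}
      \<le> measure_pmf.prob (parent_pmf {1..n}) (\<Union>v\<in>{1..n}. ?N v)"
    by (intro measure_pmf.finite_measure_mono) auto
  also have "\<dots> \<le> (\<Sum>v\<in>{1..n}. measure_pmf.prob (parent_pmf {1..n}) (?N v))"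
    by (intro measure_pmf.finite_measure_subadditive_finite) auto
  also have "\<dots> \<le> (\<Sum>v\<in>{1..n}. 1 / fact m)"
  proof (intro sum_mono)
    fix v assume v: "v \<in> {1..n}"
    have "measure_pmf.prob (parent_pmf {1..n}) (?N v)
        \<le> (card ({1..n} - {v}) * (1 / (real n - 1))) ^ m / fact m"
      unfolding parent_pmf_def using n v
      by (intro prob_many_preimages_le eq_refl[OF pmf_parent]) auto
    also have "card ({1..n} - {v}) * (1 / (real n - 1)) = 1"
      using n v by (simp add: of_nat_diff)
    finally show "measure_pmf.prob (parent_pmf {1..n}) (?N v) \<le> 1 / fact m" by simp
  qed
  finally show "measure_pmf.prob (parent_pmf {1..n})
      {f. genealogy f vs \<in> {F. Suc m \<le> max_degree n F}} \<le> real n / fact m" by simp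
qed

text \<open>
  An edge from an older to a more recent half of the vertices survives whatever the order within the
  halves is. Counting only such edges removes the dependence of degrees on the update order.
\<close>

lemma children_in_recent_half_le_max_degree:
  assumes "set (ws @ us) = {1..n}" "v \<in> set us"
  shows "card {w \<in> set ws. f w = v} \<le> max_degree n (genealogy f (ws @ us))"
proof -
  let ?G = "genealogy f (ws @ us)"
  have "finite ?G" by (induction "ws @ us") (auto intro: finite_subset[OF genealogy_subset])
  then have fin: "finite {e \<in> ?G. fst e = v}" by simp
  have "card {w \<in> set ws. f w = v} = card (Pair v ` {w \<in> set ws. f w = v})"
    by (simp add: card_image inj_on_def)
  also have "\<dots> \<le> card {e \<in> ?G. fst e = v}"
    using genealogy_older_half[of _ ws f us] assms(2) by (intro card_mono fin) auto
  also have "\<dots> \<le> total_degree ?G v" by (simp add: total_degree_def)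
  also have "\<dots> \<le> max_degree n ?G"
    unfolding max_degree_def using assms by (intro Max_ge) auto
  finally show ?thesis .
qed

text \<open>
  Up to a constant and a factor exponential in \<open>k\<close>, the binomial law with mean near \<open>1 / 2\<close> gives
  the value \<open>k\<close> at least the weight \<open>1 / fact k\<close>; the form \<open>k ^ k\<close> is as good as \<open>fact k\<close> here,
  because factors exponential in \<open>k\<close> do not affect the asymptotics of the maximal degree.
\<close>

lemma binomial_atom_ge:
  fixes n k m :: nat and q :: real
  defines "q \<equiv> 1 / (real n - 1)"
  assumes n: "n \<ge> 5" and k: "k \<ge> 1" "k \<le> m" and m: "n \<le> 2 * m" "2 * m \<le> n + 1"
  shows "1 / (4 * (2 * real k) ^ k) \<le> (m choose k) * q ^ k * (1 - q) ^ (m - k)"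
proof -
  have q: "0 < q" "q \<le> 1" using n by (auto simp: q_def field_simps)
  have mq: "1 / 2 \<le> m * q" "m * q \<le> 3 / 4"
    using n m by (auto simp: q_def field_simps)
  have "1 - m * q \<le> (1 - q) ^ m"
    using Bernoulli_inequality[of "- q" m] q by simp
  also have "\<dots> \<le> (1 - q) ^ (m - k)" using q by (intro power_decreasing) auto
  finally have b: "1 / 4 \<le> (1 - q) ^ (m - k)" using mq by linarith
  have "1 / (2 * real k) ^ k = (1 / 2 / real k) ^ k" by (simp add: power_divide)
  also have "\<dots> \<le> (m * q / real k) ^ k"
    using mq k by (intro power_mono divide_right_mono) auto
  also have "\<dots> = (real m / real k) ^ k * q ^ k" by (simp flip: power_mult_distrib)
  also have "\<dots> \<le> (m choose k) * q ^ k"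
    using binomial_ge_n_over_k_pow_k[OF k(2), where 'a = real] q by (intro mult_right_mono) auto
  finally have "1 / (2 * real k) ^ k * (1 / 4) \<le> (m choose k) * q ^ k * (1 - q) ^ (m - k)"
    using b q by (intro mult_mono) auto
  then show ?thesis by simp
qed

text \<open>
  Given the update order, consider for each vertex \<open>v\<close> of the older half \<open>H\<close> the event that exactly
  \<open>k\<close> vertices of the recent half \<open>W\<close> have chosen \<open>v\<close>. If one of these events occurs, then the
  maximal degree is at least \<open>k\<close>, and the second moment method bounds the probability that none
  occurs.
\<close>

lemma max_degree_lower_tail:
  assumes n: "n \<ge> 5" and k: "k \<ge> 1"
  shows "measure_pmf.prob (moran_forest n) {F. max_degree n F < k} \<le> 24 * (2 * real k) ^ k / n"
proof (cases "4 * k < n")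
  case False
  \<comment> \<open>For such a large \<open>k\<close> the right-hand side exceeds \<open>1\<close>.\<close>
  then have k2: "2 \<le> k" using n by linarith
  have "real n \<le> 4 * real k" using False by linarith
  also have "\<dots> \<le> (2 * real k)\<^sup>2" using k by (simp add: power2_eq_square)
  also have "\<dots> \<le> (2 * real k) ^ k" using k2 by (intro power_increasing) auto
  finally have "1 \<le> 24 * (2 * real k) ^ k / n" using n by (simp add: field_simps)
  then show ?thesis using measure_pmf.prob_le_1 order_trans by blast
next
  case kn: True
  \<comment> \<open>The older half has \<open>h\<close> vertices, and the recent half has \<open>m\<close>, which is at least \<open>h\<close>.\<close>
  define h where "h = n div 2"
  define m where "m = n - h"
  define q where "q = 1 / (real n - 1)"
  define P where "P = (m choose k) * q ^ k * (1 - q) ^ (m - k)"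
  define c where "c = 1 / (1 - q) ^ (2 * k)"
  have m: "n \<le> 2 * m" "2 * m \<le> n + 1" "2 * k \<le> m" using kn by (auto simp: m_def h_def)
  have q: "0 < q" "q \<le> 1 / 4" using n by (auto simp: q_def field_simps)
  have Plow: "1 / (4 * (2 * real k) ^ k) \<le> P"
    unfolding P_def q_def using n k m by (intro binomial_atom_ge) auto
  have P0: "P > 0" by (rule less_le_trans[OF _ Plow]) (use k in simp)
  have cross: "(m choose k)\<^sup>2 * q ^ (2 * k) * (1 - q) ^ (2 * (m - 2 * k)) = c * P\<^sup>2"
  proof -
    have e: "2 * (m - k) = 2 * (m - 2 * k) + 2 * k" using m by simp
    have "P\<^sup>2 = (m choose k)\<^sup>2 * q ^ (2 * k) * (1 - q) ^ (2 * (m - k))"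
      by (simp add: P_def power_mult_distrib mult.commute flip: power_mult)
    then show ?thesis unfolding e power_add c_def using q by simp
  qed
  have bound: "1 / (real h * P) + c - 1 \<le> 24 * (2 * real k) ^ k / n"
  proof -
    have kq: "2 * k * q \<le> 1 / 2" using kn n by (simp add: q_def field_simps)
    have "1 - 2 * k * q \<le> (1 - q) ^ (2 * k)"
      using Bernoulli_inequality[of "- q" "2 * k"] q by simp
    then have "c \<le> 1 / (1 - 2 * k * q)"
      unfolding c_def using kq by (intro divide_left_mono) (auto intro!: mult_pos_pos zero_less_power simp: q less_le_trans[OF _ q(2)])
    also have "\<dots> \<le> 1 + 2 * (2 * k * q)"
    proof -
      have "2 * k * q * (1 / 2 - 2 * k * q) \<ge> 0" using kq q by (intro mult_nonneg_nonneg) auto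
      then show ?thesis using kq by (simp add: field_simps)
    qed
    also have "2 * (2 * k * q) \<le> 8 * k / n"
      using n mult_left_mono[of 2 "real n" "real k"] by (simp add: q_def field_simps)
    finally have c: "c - 1 \<le> 8 * k / n" by simp
    have kk: "real k \<le> (2 * real k) ^ k"
      using self_le_power[of "2 * real k" k] k by simp
    have "real n / 4 \<le> h" using n by (simp add: h_def)
    then have "real n / 4 * (1 / (4 * (2 * real k) ^ k)) \<le> h * P"
      using Plow k by (intro mult_mono) auto
    then have "1 / (h * P) \<le> 1 / (real n / 4 * (1 / (4 * (2 * real k) ^ k)))"
      using n k by (intro frac_le) auto
    also have "\<dots> = 16 * (2 * real k) ^ k / n" by simp
    finally have inv: "1 / (h * P) \<le> 16 * (2 * real k) ^ k / n" .
    have "8 * k / n \<le> 8 * (2 * real k) ^ k / n"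
      using kk by (intro divide_right_mono) auto
    with inv c have "1 / (h * P) + c - 1 \<le> 16 * (2 * real k) ^ k / n + 8 * (2 * real k) ^ k / n"
      by linarith
    also have "\<dots> = 24 * (2 * real k) ^ k / n" by (simp add: add_divide_distrib[symmetric])
    finally show ?thesis .
  qed
  show ?thesis
    unfolding moran_forest_eq_genealogy_pmf[OF order_trans[OF _ n, of 2, simplified]]
  proof (rule prob_genealogy_pmf_le)
    fix vs assume "vs \<in> permutations_of_set {1..n}"
    note vs = permutations_of_setD[OF this]
    define W where "W = set (take m vs)"
    define H where "H = set (drop m vs)"
    have len: "length vs = n" using vs distinct_card[of vs] by simp
    have card: "card W = m" "card H = h"
      using vs(2) len by (simp_all add: W_def H_def distinct_card m_def h_def)
    have WH: "W \<inter> H = {}"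
      using vs(2) by (simp add: W_def H_def set_take_disj_set_drop_if_distinct)
    have WHn: "W \<subseteq> {1..n}" "H \<subseteq> {1..n}"
      using set_take_subset[of m vs] set_drop_subset[of m vs] vs(1) by (auto simp: W_def H_def)
    let ?E = "\<lambda>v. {f. card {w \<in> W. f w = v} = k}"
    have pq: "pmf (pmf_of_set ({1..n} - {w})) v = q" if "w \<in> W" "v \<in> H" for w v
      unfolding q_def using n that WH WHn by (intro pmf_parent) auto
    have "{f. genealogy f vs \<in> {F. max_degree n F < k}} \<subseteq> {f. \<forall>v\<in>H. f \<notin> ?E v}"
    proof (intro subsetI CollectI ballI)
      fix f v assume f: "f \<in> {f. genealogy f vs \<in> {F. max_degree n F < k}}" and "v \<in> H"
      then have "card {w \<in> W. f w = v} \<le> max_degree n (genealogy f vs)"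
        using children_in_recent_half_le_max_degree[of "take m vs" "drop m vs" n v f] vs(1)
        by (simp add: W_def H_def)
      with f show "f \<notin> ?E v" by simp
    qed
    then have "measure_pmf.prob (parent_pmf {1..n}) {f. genealogy f vs \<in> {F. max_degree n F < k}}
        \<le> measure_pmf.prob (parent_pmf {1..n}) {f. \<forall>v\<in>H. f \<notin> ?E v}"
      by (intro measure_pmf.finite_measure_mono) auto
    also have "\<dots> \<le> 1 / (real (card H) * P) + c - 1"
    proof -
      have "H \<noteq> {}" using card n by (auto simp: h_def)
      moreover have "c \<ge> 0" using q by (simp add: c_def)
      moreover have "measure_pmf.prob (parent_pmf {1..n}) (?E v) = P" if "v \<in> H" for v
        unfolding parent_pmf_def P_def
        by (subst prob_preimage_card_eq[where q = q]) (use WHn pq that card in auto)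
      moreover have "measure_pmf.prob (parent_pmf {1..n}) (?E u \<inter> ?E v) \<le> c * P\<^sup>2"
        if "u \<in> H" "v \<in> H" "u \<noteq> v" for u v
        using prob_two_preimages_card_eq_le[of "{1..n}" W u v "\<lambda>w. pmf_of_set ({1..n} - {w})" q undefined k]
          that WHn pq card cross by (simp add: parent_pmf_def Collect_conj_eq)
      ultimately show ?thesis
        using measure_pmf.second_moment_none_occurs[of H P c ?E "parent_pmf {1..n}"] P0
        by (simp add: H_def)
    qed
    finally show "measure_pmf.prob (parent_pmf {1..n}) {f. genealogy f vs \<in> {F. max_degree n F < k}}
        \<le> 24 * (2 * real k) ^ k / n"
      using bound card by simp
  qed
qed

section \<open>Asymptotics of the maximal degree\<close>

lemma power_self_le_exp_fact: "(real m / exp 1) ^ m \<le> fact m"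
proof -
  have s: "(\<lambda>i. real m ^ i /\<^sub>R fact i) sums exp (real m)" by (rule exp_converges)
  have "real m ^ m /\<^sub>R fact m = (\<Sum>i\<in>{m}. real m ^ i /\<^sub>R fact i)" by simp
  also have "\<dots> \<le> exp (real m)"
    using sum_le_suminf[OF sums_summable[OF s], of "{m}"] sums_unique[OF s] by simp
  also have "\<dots> = exp 1 ^ m" using exp_of_nat_mult[of m "1::real"] by simp
  finally show ?thesis by (simp add: field_simps)
qed

text \<open>
  With \<open>K \<approx> ln x / ln (ln x) * (1 + t * ln (ln (ln x)) / ln (ln x))\<close> one has
  \<open>ln K \<approx> ln (ln x) - ln (ln (ln x))\<close>, hence \<open>K * ln K \<approx> ln x + (t - 1) * ln x * ln (ln (ln x)) / ln (ln x)\<close>.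
  The case \<open>t < 1\<close> makes \<open>K powr K\<close> small compared with \<open>x\<close> and the case \<open>t > 1\<close> large, and a factor
  \<open>C powr K\<close> does not change this. The shifts by \<open>1\<close> leave room for rounding to integers and, above
  the threshold, for the incoming edge of a vertex.
\<close>

lemma lower_threshold_tendsto_0:
  fixes d :: real
  assumes "d > 0"
  defines "K \<equiv> (\<lambda>x::real. ln x / ln (ln x) + (1 - d) * (ln x * ln (ln (ln x)) / (ln (ln x))\<^sup>2) + 1)"
  shows "((\<lambda>x. 24 * (2 * K x) powr K x / x) \<longlongrightarrow> 0) at_top"
    and "eventually (\<lambda>x. K x \<ge> 1) at_top"
  using assms(1) unfolding K_def by real_asymp+

lemma upper_threshold_tendsto_0:
  fixes d :: real
  assumes "d > 0"
  defines "K \<equiv> (\<lambda>x::real. ln x / ln (ln x) + (1 + d) * (ln x * ln (ln (ln x)) / (ln (ln x))\<^sup>2) - 1)"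
  shows "((\<lambda>x. x / (K x / exp 1) powr K x) \<longlongrightarrow> 0) at_top"
    and "eventually (\<lambda>x. K x \<ge> exp 1) at_top"
  using assms(1) unfolding K_def by real_asymp+

lemma power_le_powr:
  fixes a b y :: real
  assumes "1 \<le> a" "a \<le> b" "real k \<le> y"
  shows "a ^ k \<le> b powr y"
proof -
  have "a ^ k = a powr k" using assms by (simp add: powr_realpow)
  also have "\<dots> \<le> b powr k" using assms by (intro powr_mono2) auto
  also have "\<dots> \<le> b powr y" using assms by (intro powr_mono) auto
  finally show ?thesis .
qed

lemma powr_le_power:
  fixes a b y :: real
  assumes "1 \<le> a" "a \<le> b" "y \<le> real k"
  shows "a powr y \<le> b ^ k"
proof -
  have "a powr y \<le> a powr k" using assms by (intro powr_mono) auto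
  also have "\<dots> \<le> b powr k" using assms by (intro powr_mono2) auto
  also have "\<dots> = b ^ k" using assms by (simp add: powr_realpow)
  finally show ?thesis .
qed

theorem theorem1p2:
  shows "\<exists>\<epsilon> :: nat \<Rightarrow> digraph \<Rightarrow> real.
     tendsto_0_in_prob (\<lambda>n. measure_pmf (moran_forest n)) \<epsilon> \<and>
     (\<forall>\<^sub>F n in sequentially. AE F in measure_pmf (moran_forest n).
        real (max_degree n F) =
          ln (real n) / ln (ln (real n)) +
          (1 + \<epsilon> n F) * (ln (real n) * ln (ln (ln (real n))) / (ln (ln (real n)))\<^sup>2))"
proof -
  define a :: "real \<Rightarrow> real" where "a x = ln x / ln (ln x)" for x
  define b :: "real \<Rightarrow> real" where "b x = ln x * ln (ln (ln x)) / (ln (ln x))\<^sup>2" for x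
  define \<epsilon> where "\<epsilon> n F = (real (max_degree n F) - a n) / b n - 1" for n F
  have "eventually (\<lambda>x. b x > 0) at_top" unfolding b_def by real_asymp
  then have b: "\<forall>\<^sub>F n in sequentially. b (real n) > 0"
    using filterlim_real_sequentially by (rule eventually_compose_filterlim)
  have tail: "(\<lambda>n. measure_pmf.prob (moran_forest n) {F. \<bar>\<epsilon> n F\<bar> > d}) \<longlonglongrightarrow> 0" if d: "d > 0" for d
  proof -
    \<comment> \<open>If \<open>\<epsilon> n F\<close> leaves \<open>[- d, d]\<close>, the maximal degree is above \<open>J n + 1\<close> or below \<open>K n - 1\<close>.\<close>
    define K where "K x = a x + (1 - d) * b x + 1" for x
    define J where "J x = a x + (1 + d) * b x - 1" for x
    note lo = lower_threshold_tendsto_0[OF d, folded a_def b_def, folded K_def]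
    note up = upper_threshold_tendsto_0[OF d, folded a_def b_def, folded J_def]
    have lim: "(\<lambda>n. 24 * (2 * K (real n)) powr K (real n) / n + n / (J (real n) / exp 1) powr J (real n))
        \<longlonglongrightarrow> 0"
      using tendsto_add[OF filterlim_compose[OF lo(1) filterlim_real_sequentially]
          filterlim_compose[OF up(1) filterlim_real_sequentially]] by simp
    have "\<forall>\<^sub>F n in sequentially. measure_pmf.prob (moran_forest n) {F. \<bar>\<epsilon> n F\<bar> > d} \<le>
        24 * (2 * K (real n)) powr K (real n) / n + n / (J (real n) / exp 1) powr J (real n)"
      using b eventually_ge_at_top[of 5]
        eventually_compose_filterlim[OF lo(2) filterlim_real_sequentially]
        eventually_compose_filterlim[OF up(2) filterlim_real_sequentially]
    proof eventually_elim
      case (elim n)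
      define k where "k = nat \<lfloor>K n\<rfloor>"
      define m where "m = nat \<lceil>J n\<rceil>"
      have k: "k \<ge> 1" "real k \<le> K n" "K n < real k + 1" using elim by (auto simp: k_def) linarith+
      have "0 < J n" using elim(4) exp_gt_zero[of "1::real"] by linarith
      then have m: "J n \<le> real m" "real m < J n + 1" by (auto simp: m_def) linarith+
      have "{F. \<bar>\<epsilon> n F\<bar> > d} \<subseteq> {F. max_degree n F < k} \<union> {F. Suc m \<le> max_degree n F}"
      proof
        fix F assume "F \<in> {F. \<bar>\<epsilon> n F\<bar> > d}"
        then consider "\<epsilon> n F > d" | "\<epsilon> n F < - d" by force
        then show "F \<in> {F. max_degree n F < k} \<union> {F. Suc m \<le> max_degree n F}"
        proof cases
          case 1
          then have "real (max_degree n F) > J n + 1"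
            using elim(1) by (simp add: \<epsilon>_def J_def field_simps)
          with m have "m < max_degree n F" by linarith
          then show ?thesis by simp
        next
          case 2
          then have "real (max_degree n F) < K n - 1"
            using elim(1) by (simp add: \<epsilon>_def K_def field_simps)
          with k have "max_degree n F < k" by linarith
          then show ?thesis by simp
        qed
      qed
      then have "measure_pmf.prob (moran_forest n) {F. \<bar>\<epsilon> n F\<bar> > d} \<le>
          measure_pmf.prob (moran_forest n) ({F. max_degree n F < k} \<union> {F. Suc m \<le> max_degree n F})"
        by (intro measure_pmf.finite_measure_mono) auto
      also have "\<dots> \<le> measure_pmf.prob (moran_forest n) {F. max_degree n F < k} +
          measure_pmf.prob (moran_forest n) {F. Suc m \<le> max_degree n F}"
        by (intro measure_Un_le) auto
      also have "\<dots> \<le> 24 * (2 * real k) ^ k / n + n / fact m"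
        using elim(2) k by (intro add_mono max_degree_lower_tail max_degree_upper_tail) auto
      also have "\<dots> \<le> 24 * (2 * K n) powr K n / n + n / (J n / exp 1) powr J n"
      proof (intro add_mono divide_right_mono mult_left_mono divide_left_mono)
        show "(2 * real k) ^ k \<le> (2 * K n) powr K n" using k by (intro power_le_powr) auto
        have "(J n / exp 1) powr J n \<le> (real m / exp 1) ^ m"
          using elim(4) m by (intro powr_le_power divide_right_mono) (auto simp: field_simps)
        also have "\<dots> \<le> fact m" by (rule power_self_le_exp_fact)
        finally show "(J n / exp 1) powr J n \<le> fact m" .
        show "0 < fact m * (J n / exp 1) powr J n" using \<open>0 < J n\<close> by simp
      qed auto
      finally show ?case .
    qed
    then show ?thesis
      by (intro tendsto_sandwich[OF _ _ tendsto_const lim]) auto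
  qed
  have "tendsto_0_in_prob (\<lambda>n. measure_pmf (moran_forest n)) \<epsilon>"
    using tail by (simp add: tendsto_0_in_prob_def)
  moreover have "\<forall>\<^sub>F n in sequentially. AE F in measure_pmf (moran_forest n).
        real (max_degree n F) = a n + (1 + \<epsilon> n F) * b n"
    using b by eventually_elim (auto simp: \<epsilon>_def)
  ultimately show ?thesis unfolding a_def b_def by blast
qed

end
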